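(* Let $(G,\cdot,e)$ be an abelian group with identity $e$. The following five conditions are equivalent: (i) $L(G)$ is a distributive lattice; (ii) $G$ is a locally cyclic group; (iii) $L(G)$ is pseudocomplemented; (iv) $L(G)$ contains no 0-sublattice isomorphic to one of the lattices $M_3$ and $M_{2,3}$; (v) $G$ contains no three subgroups $U,V,W$, each different from the trivial subgroup $\{e\}$, with $U\cap W=V\cap W=\{e\}$ and $U\vee V=U\vee W=V\vee W$ (i.e. $UV=UW=VW$).
   Context: $L(G)$ denotes the lattice of all subgroups of $G$ ordered by inclusion, with meet $A\wedge B=A\cap B$ and join $A\vee B$ the subgroup generated by $A\cup B$ (which equals $AB$ when $G$ is abelian); its least element is $\{e\}$. A group is locally cyclic if each of its finitely generated subgroups is cyclic. Pseudocomplemented: for a lattice $L$ with least element $0$, an element $a^*\in L$ is a pseudocomplement of $a\in L$ if $a\wedge a^*=0$ and, for all $x\in L$, $a\wedge x=0$ implies $x\le a^*$. The lattice $L$ is pseudocomplemented if each of its elements has a pseudocomplement. 0-sublattice: a sublattice of a lattice with least element $0$ (closed under $\vee$ and $\wedge$) is a 0-sublattice if it contains $0$. $M_3$ is the five-element lattice with a least element, a greatest element and three pairwise incomparable elements strictly between them. $M_{2,3}$ is the seven-element lattice with elements $0,d,c,a,b,f,1'$ whose covering relations are exactly: $0\prec d$, $0\prec c$, $d\prec a$, $d\prec b$, $d\prec f$, $c\prec f$, $a\prec 1'$, $b\prec 1'$, $f\prec 1'$ (so $0$ is its least element, $1'$ its greatest element, and $f=c\vee d$). *)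

theory Defs
  imports "HOL-Algebra.Elementary_Groups"
begin

section \<open>Lattice notions\<close>

definition distributive_lattice :: "('a, 'c) gorder_scheme \<Rightarrow> bool" where
  "distributive_lattice L \<longleftrightarrow> lattice L \<and>
     (\<forall>x\<in>carrier L. \<forall>y\<in>carrier L. \<forall>z\<in>carrier L.
        x \<sqinter>\<^bsub>L\<^esub> (y \<squnion>\<^bsub>L\<^esub> z) = (x \<sqinter>\<^bsub>L\<^esub> y) \<squnion>\<^bsub>L\<^esub> (x \<sqinter>\<^bsub>L\<^esub> z))"

definition is_pseudocomplement :: "('a, 'c) gorder_scheme \<Rightarrow> 'a \<Rightarrow> 'a \<Rightarrow> bool" where
  "is_pseudocomplement L a s \<longleftrightarrow> s \<in> carrier L \<and> a \<sqinter>\<^bsub>L\<^esub> s = \<bottom>\<^bsub>L\<^esub> \<and>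
     (\<forall>x\<in>carrier L. a \<sqinter>\<^bsub>L\<^esub> x = \<bottom>\<^bsub>L\<^esub> \<longrightarrow> x \<sqsubseteq>\<^bsub>L\<^esub> s)"

definition pseudocomplemented :: "('a, 'c) gorder_scheme \<Rightarrow> bool" where
  "pseudocomplemented L \<longleftrightarrow> (\<forall>a\<in>carrier L. \<exists>s. is_pseudocomplement L a s)"

definition zero_sublattice :: "('a, 'c) gorder_scheme \<Rightarrow> 'a set \<Rightarrow> bool" where
  "zero_sublattice L S \<longleftrightarrow> S \<subseteq> carrier L \<and> \<bottom>\<^bsub>L\<^esub> \<in> S \<and>
     (\<forall>x\<in>S. \<forall>y\<in>S. x \<squnion>\<^bsub>L\<^esub> y \<in> S \<and> x \<sqinter>\<^bsub>L\<^esub> y \<in> S)"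

text \<open>\<^const>\<open>join_pres\<close> and \<^const>\<open>meet_pres\<close> also require both structures to be lattices.\<close>

definition lattice_isomorphic :: "('a, 'c) gorder_scheme \<Rightarrow> ('b, 'd) gorder_scheme \<Rightarrow> bool" where
  "lattice_isomorphic L M \<longleftrightarrow>
     (\<exists>h. bij_betw h (carrier L) (carrier M) \<and> join_pres L M h \<and> meet_pres L M h)"

section \<open>The lattices \<open>M\<^sub>3\<close> and \<open>M\<^sub>2\<^sub>,\<^sub>3\<close>\<close>

text \<open>Both lattices are given by their covering relations; the order is the reflexive-transitive
  closure.\<close>

definition hasse :: "('a \<times> 'a) set \<Rightarrow> 'a gorder" where
  "hasse C = \<lparr>carrier = UNIV, eq = (=), le = (\<lambda>x y. (x, y) \<in> C\<^sup>*)\<rparr>"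

datatype m3 = M3_0 | M3_a | M3_b | M3_c | M3_1

definition M3_covers :: "(m3 \<times> m3) set" where
  "M3_covers = {(M3_0, M3_a), (M3_0, M3_b), (M3_0, M3_c), (M3_a, M3_1), (M3_b, M3_1), (M3_c, M3_1)}"

definition M3 :: "m3 gorder" where
  "M3 = hasse M3_covers"

datatype m23 = M23_0 | M23_d | M23_c | M23_a | M23_b | M23_f | M23_1

definition M23_covers :: "(m23 \<times> m23) set" where
  "M23_covers = {(M23_0, M23_d), (M23_0, M23_c), (M23_d, M23_a), (M23_d, M23_b), (M23_d, M23_f),
     (M23_c, M23_f), (M23_a, M23_1), (M23_b, M23_1), (M23_f, M23_1)}"

definition M23 :: "m23 gorder" where
  "M23 = hasse M23_covers"

lemma m3_ex: "(\<exists>x. P x) \<longleftrightarrow> P M3_0 \<or> P M3_a \<or> P M3_b \<or> P M3_c \<or> P M3_1"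
  by (metis m3.exhaust)

lemma m3_all: "(\<forall>x. P x) \<longleftrightarrow> P M3_0 \<and> P M3_a \<and> P M3_b \<and> P M3_c \<and> P M3_1"
  by (metis m3.exhaust)

lemma m23_ex: "(\<exists>x. P x) \<longleftrightarrow>
    P M23_0 \<or> P M23_d \<or> P M23_c \<or> P M23_a \<or> P M23_b \<or> P M23_f \<or> P M23_1"
  by (metis m23.exhaust)

lemma m23_all: "(\<forall>x. P x) \<longleftrightarrow>
    P M23_0 \<and> P M23_d \<and> P M23_c \<and> P M23_a \<and> P M23_b \<and> P M23_f \<and> P M23_1"
  by (metis m23.exhaust)

lemma M3_le_iff: "x \<sqsubseteq>\<^bsub>M3\<^esub> y \<longleftrightarrow> x = M3_0 \<or> x = y \<or> y = M3_1"
proof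
  have "(x, y) \<in> M3_covers\<^sup>* \<Longrightarrow> x = M3_0 \<or> x = y \<or> y = M3_1"
    by (induction rule: rtrancl_induct) (auto simp: M3_covers_def)
  then show "x \<sqsubseteq>\<^bsub>M3\<^esub> y \<Longrightarrow> x = M3_0 \<or> x = y \<or> y = M3_1"
    by (simp add: M3_def hasse_def)
next
  have step: "(u, v) \<in> M3_covers \<Longrightarrow> (u, v) \<in> M3_covers\<^sup>*" for u v
    by blast
  have c: "(M3_0, M3_a) \<in> M3_covers\<^sup>*" "(M3_0, M3_b) \<in> M3_covers\<^sup>*"
      "(M3_0, M3_c) \<in> M3_covers\<^sup>*" "(M3_a, M3_1) \<in> M3_covers\<^sup>*"
      "(M3_b, M3_1) \<in> M3_covers\<^sup>*" "(M3_c, M3_1) \<in> M3_covers\<^sup>*"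
    by (rule step, simp add: M3_covers_def)+
  have bt: "(M3_0, M3_1) \<in> M3_covers\<^sup>*"
    using c by (meson rtrancl_trans)
  have bot: "(M3_0, v) \<in> M3_covers\<^sup>*" for v
    by (cases v) (simp_all add: c bt)
  have top: "(v, M3_1) \<in> M3_covers\<^sup>*" for v
    by (cases v) (simp_all add: c bt)
  show "x = M3_0 \<or> x = y \<or> y = M3_1 \<Longrightarrow> x \<sqsubseteq>\<^bsub>M3\<^esub> y"
    using bot top by (auto simp: M3_def hasse_def)
qed

lemma M23_le_iff: "x \<sqsubseteq>\<^bsub>M23\<^esub> y \<longleftrightarrow>
    x = M23_0 \<or> x = y \<or> y = M23_1 \<or> (x = M23_d \<and> y \<in> {M23_a, M23_b, M23_f}) \<or> (x = M23_c \<and> y = M23_f)"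
    (is "_ \<longleftrightarrow> ?R x y")
proof
  have "(x, y) \<in> M23_covers\<^sup>* \<Longrightarrow> ?R x y"
    by (induction rule: rtrancl_induct) (auto simp: M23_covers_def)
  then show "x \<sqsubseteq>\<^bsub>M23\<^esub> y \<Longrightarrow> ?R x y"
    by (simp add: M23_def hasse_def)
next
  have step: "(u, v) \<in> M23_covers \<Longrightarrow> (u, v) \<in> M23_covers\<^sup>*" for u v
    by blast
  have d: "(M23_0, M23_d) \<in> M23_covers\<^sup>*" "(M23_d, M23_a) \<in> M23_covers\<^sup>*"
      "(M23_d, M23_b) \<in> M23_covers\<^sup>*" "(M23_d, M23_f) \<in> M23_covers\<^sup>*"
      "(M23_0, M23_c) \<in> M23_covers\<^sup>*" "(M23_c, M23_f) \<in> M23_covers\<^sup>*"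
      "(M23_a, M23_1) \<in> M23_covers\<^sup>*" "(M23_b, M23_1) \<in> M23_covers\<^sup>*"
      "(M23_f, M23_1) \<in> M23_covers\<^sup>*"
    by (rule step, simp add: M23_covers_def)+
  have d1: "(M23_d, M23_1) \<in> M23_covers\<^sup>*" "(M23_c, M23_1) \<in> M23_covers\<^sup>*"
    using d by (meson rtrancl_trans)+
  have d2: "(M23_0, v) \<in> M23_covers\<^sup>*" if "(M23_d, v) \<in> M23_covers\<^sup>*" for v
    using d(1) that by (rule rtrancl_trans)
  have top: "(v, M23_1) \<in> M23_covers\<^sup>*" for v
    by (cases v) (simp_all add: d d1 d2)
  have bot: "(M23_0, v) \<in> M23_covers\<^sup>*" for v
    by (cases v) (simp_all add: d d1 d2)
  show "?R x y \<Longrightarrow> x \<sqsubseteq>\<^bsub>M23\<^esub> y"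
    using bot top d by (auto simp: M23_def hasse_def)
qed

lemma M3_simps [simp]: "carrier M3 = UNIV" "eq M3 = (=)"
  by (simp_all add: M3_def hasse_def)

lemma M23_simps [simp]: "carrier M23 = UNIV" "eq M23 = (=)"
  by (simp_all add: M23_def hasse_def)

lemma M3_lattice: "lattice M3"
proof unfold_locales
  fix x y
  show "\<exists>s. least M3 s (Upper M3 {x, y})"
    by (cases x; cases y) (simp_all add: least_def Upper_def m3_ex m3_all M3_le_iff subset_iff)
  show "\<exists>s. greatest M3 s (Lower M3 {x, y})"
    by (cases x; cases y) (simp_all add: greatest_def Lower_def m3_ex m3_all M3_le_iff subset_iff)
qed (auto simp: M3_le_iff)

lemma M23_lattice: "lattice M23"
proof unfold_locales
  fix x y
  show "\<exists>s. least M23 s (Upper M23 {x, y})"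
    by (cases x; cases y) (simp_all add: least_def Upper_def m23_ex m23_all M23_le_iff subset_iff)
  show "\<exists>s. greatest M23 s (Lower M23 {x, y})"
    by (cases x; cases y) (simp_all add: greatest_def Lower_def m23_ex m23_all M23_le_iff subset_iff)
qed (auto simp: M23_le_iff)

lemma M23_covers_exact:
  "(x, y) \<in> M23_covers \<longleftrightarrow>
     x \<sqsubset>\<^bsub>M23\<^esub> y \<and> \<not> (\<exists>z. x \<sqsubset>\<^bsub>M23\<^esub> z \<and> z \<sqsubset>\<^bsub>M23\<^esub> y)"
  by (cases x; cases y) (simp_all add: M23_covers_def lless_def m23_ex M23_le_iff)

section \<open>The subgroup lattice\<close>

definition subgroup_lattice :: "('a, 'b) monoid_scheme \<Rightarrow> 'a set gorder" where
  "subgroup_lattice G = \<lparr>carrier = {H. subgroup H G}, eq = (=), le = (\<subseteq>)\<rparr>"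

definition locally_cyclic :: "('a, 'b) monoid_scheme \<Rightarrow> bool" where
  "locally_cyclic G \<longleftrightarrow>
     (\<forall>A. finite A \<and> A \<subseteq> carrier G \<longrightarrow> cyclic_group (subgroup_generated G A))"

context group
begin

lemma subgroup_lattice_complete: "complete_lattice (subgroup_lattice G)"
  unfolding subgroup_lattice_def by (rule subgroups_complete_lattice)

lemma subgroup_lattice_lattice: "lattice (subgroup_lattice G)"
proof -
  interpret L: complete_lattice "subgroup_lattice G" by (rule subgroup_lattice_complete)
  show ?thesis by (rule L.lattice_axioms)
qed

lemma subgroup_lattice_bottom: "\<bottom>\<^bsub>subgroup_lattice G\<^esub> = {\<one>}"
proof -
  interpret L: complete_lattice "subgroup_lattice G" by (rule subgroup_lattice_complete)
  have "\<bottom>\<^bsub>subgroup_lattice G\<^esub> \<in> carrier (subgroup_lattice G)"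
    by (rule L.bottom_closed)
  moreover have "{\<one>} \<in> carrier (subgroup_lattice G)"
    by (simp add: subgroup_lattice_def triv_subgroup)
  moreover from this have "\<bottom>\<^bsub>subgroup_lattice G\<^esub> \<subseteq> {\<one>}"
    using L.bottom_lower by (simp add: subgroup_lattice_def)
  ultimately show ?thesis
    by (auto simp: subgroup_lattice_def dest: subgroup.one_closed)
qed

lemma subgroup_lattice_meet:
  assumes "subgroup H G" "subgroup K G"
  shows "H \<sqinter>\<^bsub>subgroup_lattice G\<^esub> K = H \<inter> K"
proof -
  interpret L: lattice "subgroup_lattice G" by (rule subgroup_lattice_lattice)
  have "greatest (subgroup_lattice G) (H \<inter> K) (Lower (subgroup_lattice G) {H, K})"
    using assms subgroups_Inter_pair[of H K]
    by (auto simp: greatest_def Lower_def subgroup_lattice_def)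
  moreover have "H \<in> carrier (subgroup_lattice G)" "K \<in> carrier (subgroup_lattice G)"
    using assms by (auto simp: subgroup_lattice_def)
  ultimately show ?thesis
    by (metis L.greatest_unique L.inf_of_two_greatest meet_def)
qed

lemma subgroup_lattice_join:
  assumes "subgroup H G" "subgroup K G"
  shows "H \<squnion>\<^bsub>subgroup_lattice G\<^esub> K = generate G (H \<union> K)"
proof -
  interpret L: lattice "subgroup_lattice G" by (rule subgroup_lattice_lattice)
  have sub: "H \<union> K \<subseteq> carrier G"
    using assms subgroup.subset by blast
  have "least (subgroup_lattice G) (generate G (H \<union> K)) (Upper (subgroup_lattice G) {H, K})"
    using assms generate_is_subgroup[OF sub] generate_subgroup_incl[of "H \<union> K"] 
    by (auto simp: least_def Upper_def subgroup_lattice_def intro: generate.incl)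
  moreover have "H \<in> carrier (subgroup_lattice G)" "K \<in> carrier (subgroup_lattice G)"
    using assms by (auto simp: subgroup_lattice_def)
  ultimately show ?thesis
    by (metis L.least_unique L.sup_of_two_least join_def)
qed

end

end

theory Submission
  imports Defs "HOL-Algebra.Multiplicative_Group" "HOL-Library.Product_Plus"
begin

text \<open>
  The conditions are linked by a cycle of implications through an auxiliary one, \<open>common_roots\<close>:
  any two elements are powers of a single element. Induction on a finite generating set shows that
  this is local cyclicity (\<open>locally_cyclic_iff_common_roots\<close>). The cycle is

  \<^item> Common roots imply distributivity (\<open>distributive_if_common_roots\<close>): a relation \<open>u = v w\<close>
    between elements of \<open>U\<close>, \<open>V\<close> and \<open>W\<close> takes place in one cyclic group, where Bezout's identity
    splits \<open>u\<close> into a power lying in \<open>V\<close> and a power lying in \<open>W\<close>.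
  \<^item> Distributivity implies pseudocomplements (\<open>pseudocomplemented_if_distributive\<close>): the
    subgroups that meet \<open>W\<close> trivially are then closed under joins, so their union is the largest
    of them.
  \<^item> Pseudocomplements exclude the triples of subgroups in the last condition, here called
    entangled (\<open>pseudocomplemented_not_entangled\<close>): the pseudocomplement of \<open>W\<close> would contain \<open>U\<close>
    and \<open>V\<close>, hence their join, hence \<open>W\<close> itself.
  \<^item> Both forbidden lattices contain an entangled triple, and a 0-sublattice has the same joins,
    meets and bottom as the whole lattice, so without entangled triples neither lattice occurs
    (\<open>entangled_of_zero_sublattice\<close>).
  \<^item> Without common roots one of the two lattices occurs
    (\<open>forbidden_sublattice_if_no_common_roots\<close>).

  For the last step, suppose that \<open>x\<close> and \<open>y\<close> have no common root. Instead of decomposing the group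
  that they generate into cyclic factors, look at all pairs \<open>(u, v)\<close> that span a subgroup containing
  \<open>x\<close> and \<open>y\<close>. If \<open>x\<close> and \<open>y\<close> satisfy only the trivial relation, the group contains a copy of
  \<open>\<int> \<times> \<int>\<close>. Otherwise a unimodular change of the pair turns a non-trivial relation with exponents \<open>a\<close>
  and \<open>b\<close> into torsion \<open>v ^ gcd a b = 1\<close> (\<open>relation_to_torsion\<close>). In a pair for which the order \<open>d\<close> of
  \<open>v\<close> is minimal, the exponents of a non-trivial relation thus have a gcd of at least \<open>d\<close>. This forces
  the cyclic groups of \<open>u\<close> and \<open>v\<close> to be independent, and forces \<open>d\<close> to divide the order of \<open>u\<close>
  when that is finite. Hence the group contains a copy of \<open>\<int>_d \<times> \<int>_d\<close> or of \<open>\<int> \<times> \<int>_d\<close>, with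
  \<open>d > 1\<close> (\<open>standard_pair_if_no_common_roots\<close>). In \<open>\<int>_m \<times> \<int>_m\<close>, where \<open>m = 0\<close> gives \<open>\<int> \<times> \<int>\<close>, the
  two axes and the diagonal span a copy of \<open>M\<^sub>3\<close>; in \<open>\<int> \<times> \<int>_m\<close> the graphs of \<open>0\<close> and of the
  reduction map, together with the torsion subgroup, generate a copy of \<open>M\<^sub>2\<^sub>,\<^sub>3\<close>. All these
  subgroups are images of explicit lattices of exponent pairs in \<open>\<int> \<times> \<int>\<close>, which reduces the
  verification to divisibility of integers (\<open>zero_sublattice_of_exponents\<close>).
\<close>

section \<open>Joins, meets and sublattices\<close>

lemma (in lattice) join_eqI:
  assumes "x \<in> carrier L" "y \<in> carrier L" "s \<in> carrier L" "x \<sqsubseteq> s" "y \<sqsubseteq> s"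
    and "\<And>t. t \<in> carrier L \<Longrightarrow> x \<sqsubseteq> t \<Longrightarrow> y \<sqsubseteq> t \<Longrightarrow> s \<sqsubseteq> t"
  shows "x \<squnion> y = s"
  by (intro le_antisym join_le assms join_closed join_left join_right)

lemma (in lattice) meet_eqI:
  assumes "x \<in> carrier L" "y \<in> carrier L" "s \<in> carrier L" "s \<sqsubseteq> x" "s \<sqsubseteq> y"
    and "\<And>t. t \<in> carrier L \<Longrightarrow> t \<sqsubseteq> x \<Longrightarrow> t \<sqsubseteq> y \<Longrightarrow> t \<sqsubseteq> s"
  shows "x \<sqinter> y = s"
  by (intro le_antisym meet_le assms meet_closed meet_left meet_right)

lemma (in lattice) sublattice:
  assumes S: "S \<subseteq> carrier L"
    and closed: "\<And>x y. x \<in> S \<Longrightarrow> y \<in> S \<Longrightarrow> x \<squnion> y \<in> S"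
      "\<And>x y. x \<in> S \<Longrightarrow> y \<in> S \<Longrightarrow> x \<sqinter> y \<in> S"
  shows "lattice (L\<lparr>carrier := S\<rparr>)"
    and "\<And>x y. x \<in> S \<Longrightarrow> y \<in> S \<Longrightarrow> x \<squnion>\<^bsub>L\<lparr>carrier := S\<rparr>\<^esub> y = x \<squnion> y"
    and "\<And>x y. x \<in> S \<Longrightarrow> y \<in> S \<Longrightarrow> x \<sqinter>\<^bsub>L\<lparr>carrier := S\<rparr>\<^esub> y = x \<sqinter> y"
proof -
  let ?S = "L\<lparr>carrier := S\<rparr>"
  have S': "x \<in> carrier L" if "x \<in> S" for x
    using S that by blast
  have lub: "least ?S (x \<squnion> y) (Upper ?S {x, y})" if "x \<in> S" "y \<in> S" for x y
    by (rule least_UpperI) (use that closed S' in \<open>auto simp: Upper_def intro: join_left join_right join_le\<close>)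
  have glb: "greatest ?S (x \<sqinter> y) (Lower ?S {x, y})" if "x \<in> S" "y \<in> S" for x y
    by (rule greatest_LowerI) (use that closed S' in \<open>auto simp: Lower_def intro: meet_left meet_right meet_le\<close>)
  interpret S: partial_order ?S
    by unfold_locales (auto simp: eq_is_equal intro: le_antisym dest: S' le_trans)
  interpret S: lattice ?S
    by (unfold_locales; simp) (use lub glb in blast)+
  show "lattice ?S"
    by (rule S.lattice_axioms)
  show "x \<squnion>\<^bsub>?S\<^esub> y = x \<squnion> y" if "x \<in> S" "y \<in> S" for x y
    using S.least_unique[OF S.sup_of_two_least lub[OF that]] that by (simp add: join_def)
  show "x \<sqinter>\<^bsub>?S\<^esub> y = x \<sqinter> y" if "x \<in> S" "y \<in> S" for x y
    using S.greatest_unique[OF S.inf_of_two_greatest glb[OF that]] that by (simp add: meet_def)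
qed

section \<open>Entangled triples\<close>

text \<open>
  Stated for an arbitrary lattice, so that a triple found in one of the two finite lattices can be
  carried over to the subgroup lattice.
\<close>

definition entangled :: "('a, 'c) gorder_scheme \<Rightarrow> 'a \<Rightarrow> 'a \<Rightarrow> 'a \<Rightarrow> bool" where
  "entangled L u v w \<longleftrightarrow> u \<in> carrier L \<and> v \<in> carrier L \<and> w \<in> carrier L \<and>
     u \<noteq> \<bottom>\<^bsub>L\<^esub> \<and> v \<noteq> \<bottom>\<^bsub>L\<^esub> \<and> w \<noteq> \<bottom>\<^bsub>L\<^esub> \<and>
     u \<sqinter>\<^bsub>L\<^esub> w = \<bottom>\<^bsub>L\<^esub> \<and> v \<sqinter>\<^bsub>L\<^esub> w = \<bottom>\<^bsub>L\<^esub> \<and>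
     u \<squnion>\<^bsub>L\<^esub> v = u \<squnion>\<^bsub>L\<^esub> w \<and> u \<squnion>\<^bsub>L\<^esub> w = v \<squnion>\<^bsub>L\<^esub> w"

text \<open>
  A pseudocomplement \<open>s\<close> of \<open>w\<close> lies above \<open>u\<close> and \<open>v\<close>, hence above \<open>u \<squnion> v = u \<squnion> w\<close>, hence above \<open>w\<close>;
  but then \<open>w = w \<sqinter> s = \<bottom>\<close>.
\<close>
lemma (in bounded_lattice) pseudocomplemented_not_entangled:
  assumes "pseudocomplemented L"
  shows "\<not> entangled L u v w"
proof
  assume e: "entangled L u v w"
  then obtain s where s: "s \<in> carrier L" "w \<sqinter> s = \<bottom>"
      "\<And>x. x \<in> carrier L \<Longrightarrow> w \<sqinter> x = \<bottom> \<Longrightarrow> x \<sqsubseteq> s"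
    using assms unfolding pseudocomplemented_def is_pseudocomplement_def entangled_def by metis
  have uvw: "u \<in> carrier L" "v \<in> carrier L" "w \<in> carrier L" "w \<noteq> \<bottom>"
    using e by (auto simp: entangled_def)
  have "u \<sqsubseteq> s" "v \<sqsubseteq> s"
    using e s(3) by (auto simp: entangled_def meet_comm[of L w])
  then have "u \<squnion> v \<sqsubseteq> s"
    using uvw s(1) by (intro join_le)
  moreover have "w \<sqsubseteq> u \<squnion> v"
    using e join_right[of u w] by (simp add: entangled_def)
  ultimately have "w \<sqsubseteq> s"
    using uvw s(1) by (meson le_trans join_closed)
  then show False
    using s uvw le_iff_join by metis
qed

text \<open>
  Pull the triple back along the isomorphism \<open>h\<close>: joins and meets in \<open>S\<close> are those of \<open>L\<close>, and \<open>h\<close>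
  maps the bottom of \<open>L\<close> to a least element of \<open>M\<close> because that bottom lies in \<open>S\<close>. For a sublattice
  with a different bottom, the trivial intersections would be lost.
\<close>
lemma (in bounded_lattice) entangled_of_zero_sublattice:
  assumes S: "zero_sublattice L S" and iso: "lattice_isomorphic (L\<lparr>carrier := S\<rparr>) M"
    and e: "entangled M u v w"
  shows "\<exists>u v w. entangled L u v w"
proof -
  note SD = S[unfolded zero_sublattice_def]
  have sub: "lattice (L\<lparr>carrier := S\<rparr>)"
    "\<And>x y. x \<in> S \<Longrightarrow> y \<in> S \<Longrightarrow> x \<squnion>\<^bsub>L\<lparr>carrier := S\<rparr>\<^esub> y = x \<squnion> y"
    "\<And>x y. x \<in> S \<Longrightarrow> y \<in> S \<Longrightarrow> x \<sqinter>\<^bsub>L\<lparr>carrier := S\<rparr>\<^esub> y = x \<sqinter> y"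
    using SD by (auto intro!: sublattice)
  obtain h where h: "bij_betw h S (carrier M)" and M: "lattice M"
    and hj: "\<And>x y. x \<in> S \<Longrightarrow> y \<in> S \<Longrightarrow> h (x \<squnion> y) = h x \<squnion>\<^bsub>M\<^esub> h y"
    and hm: "\<And>x y. x \<in> S \<Longrightarrow> y \<in> S \<Longrightarrow> h (x \<sqinter> y) = h x \<sqinter>\<^bsub>M\<^esub> h y"
    using iso sub(2,3) by (auto simp: lattice_isomorphic_def join_pres_def meet_pres_def)
  interpret M: lattice M by (rule M)
  have bot: "\<bottom> \<in> S" and SL: "\<And>x. x \<in> S \<Longrightarrow> x \<in> carrier L"
    using SD by auto
  have hS: "h x \<in> carrier M" if "x \<in> S" for x
    using h that by (auto simp: bij_betw_def)
  have "h \<bottom> \<sqsubseteq>\<^bsub>M\<^esub> m" if "m \<in> carrier M" for m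
  proof -
    have "m \<in> h ` S"
      using that h by (simp add: bij_betw_imp_surj_on)
    then obtain s where s: "s \<in> S" "m = h s"
      by blast
    have "\<bottom> = \<bottom> \<sqinter> s"
      using s(1) SL bottom_meet eq_is_equal by simp
    then have "h \<bottom> = h \<bottom> \<sqinter>\<^bsub>M\<^esub> h s"
      using hm[OF bot s(1)] by simp
    then show ?thesis
      using M.le_iff_join[of "h \<bottom>" m] s hS bot by simp
  qed
  then have "least M (h \<bottom>) (carrier M)"
    using hS[OF bot] by (auto simp: least_def)
  then interpret M: weak_partial_order_bottom M
    by unfold_locales auto
  have hbot: "h \<bottom> = \<bottom>\<^bsub>M\<^esub>"
    using \<open>least M (h \<bottom>) (carrier M)\<close> M.bottom_least by (rule M.least_unique)
  obtain u' v' w' where S': "u' \<in> S" "v' \<in> S" "w' \<in> S" and h': "h u' = u" "h v' = v" "h w' = w"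
    using e h unfolding entangled_def bij_betw_def by (metis imageE)
  have inj: "x = y" if "h x = h y" "x \<in> S" "y \<in> S" for x y
    using h that by (auto simp: bij_betw_def inj_on_def)
  have cl: "x \<squnion> y \<in> S" "x \<sqinter> y \<in> S" if "x \<in> S" "y \<in> S" for x y
    using SD that by auto
  have "u' \<sqinter> w' = \<bottom>" "v' \<sqinter> w' = \<bottom>"
    using e S' by (intro inj cl bot; simp add: entangled_def hm h' hbot)+
  moreover have "u' \<squnion> v' = u' \<squnion> w'" "u' \<squnion> w' = v' \<squnion> w'"
    using e S' by (intro inj cl; simp add: entangled_def hj h')+
  moreover have "u' \<noteq> \<bottom>" "v' \<noteq> \<bottom>" "w' \<noteq> \<bottom>"
    using e h' hbot by (auto simp: entangled_def)
  ultimately have "entangled L u' v' w'"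
    using S' SL by (simp add: entangled_def)
  then show ?thesis by blast
qed

section \<open>The two forbidden lattices\<close>

lemma M3_join: "x \<squnion>\<^bsub>M3\<^esub> y =
    (if x \<sqsubseteq>\<^bsub>M3\<^esub> y then y else if y \<sqsubseteq>\<^bsub>M3\<^esub> x then x else M3_1)"
  by (rule lattice.join_eqI[OF M3_lattice]; cases x; cases y) (auto simp: M3_le_iff)

lemma M3_meet: "x \<sqinter>\<^bsub>M3\<^esub> y =
    (if x \<sqsubseteq>\<^bsub>M3\<^esub> y then x else if y \<sqsubseteq>\<^bsub>M3\<^esub> x then y else M3_0)"
  by (rule lattice.meet_eqI[OF M3_lattice]; cases x; cases y) (auto simp: M3_le_iff)

lemma M23_join: "x \<squnion>\<^bsub>M23\<^esub> y =
    (if x \<sqsubseteq>\<^bsub>M23\<^esub> y then y else if y \<sqsubseteq>\<^bsub>M23\<^esub> x then x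
     else if {x, y} = {M23_c, M23_d} then M23_f else M23_1)"
  by (rule lattice.join_eqI[OF M23_lattice]; cases x; cases y) (auto simp: M23_le_iff)

lemma M23_meet: "x \<sqinter>\<^bsub>M23\<^esub> y =
    (if x \<sqsubseteq>\<^bsub>M23\<^esub> y then x else if y \<sqsubseteq>\<^bsub>M23\<^esub> x then y
     else if M23_c \<in> {x, y} then M23_0 else M23_d)"
  by (rule lattice.meet_eqI[OF M23_lattice]; cases x; cases y) (auto simp: M23_le_iff)

lemma bottom_eqI:
  assumes "partial_order L" "b \<in> carrier L" "\<And>x. x \<in> carrier L \<Longrightarrow> b \<sqsubseteq>\<^bsub>L\<^esub> x"
  shows "\<bottom>\<^bsub>L\<^esub> = b"
proof -
  interpret partial_order L by (rule assms)
  have "least L b (carrier L)"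
    using assms by (auto simp: least_def)
  then show ?thesis
    unfolding bottom_def by (blast intro: least_unique)
qed

lemma M3_bottom: "\<bottom>\<^bsub>M3\<^esub> = M3_0"
  using M3_lattice[unfolded lattice_def upper_semilattice_def] by (intro bottom_eqI) (auto simp: M3_le_iff)

lemma M23_bottom: "\<bottom>\<^bsub>M23\<^esub> = M23_0"
  using M23_lattice[unfolded lattice_def upper_semilattice_def] by (intro bottom_eqI) (auto simp: M23_le_iff)

lemma M3_entangled: "entangled M3 M3_a M3_b M3_c"
  by (simp add: entangled_def M3_bottom M3_join M3_meet M3_le_iff)

lemma M23_entangled: "entangled M23 M23_a M23_b M23_c"
  by (simp add: entangled_def M23_bottom M23_join M23_meet M23_le_iff doubleton_eq_iff)

section \<open>Integer combinations of two elements\<close>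

context comm_group
begin

text \<open>
  The homomorphism from \<open>\<int> \<times> \<int>\<close> that sends the two unit vectors to \<open>x\<close> and \<open>y\<close>; its kernel is the
  lattice of relations between \<open>x\<close> and \<open>y\<close>. Exponents are kept as pairs to have the additive group
  structure of \<open>\<int> \<times> \<int>\<close> at hand.
\<close>
definition lincomb :: "'a \<Rightarrow> 'a \<Rightarrow> int \<times> int \<Rightarrow> 'a" where
  "lincomb x y p = x [^] fst p \<otimes> y [^] snd p"

lemma lincomb_closed [simp]:
  "x \<in> carrier G \<Longrightarrow> y \<in> carrier G \<Longrightarrow> lincomb x y p \<in> carrier G"
  by (simp add: lincomb_def)

lemma lincomb_add:
  "x \<in> carrier G \<Longrightarrow> y \<in> carrier G \<Longrightarrow> lincomb x y (p + q) = lincomb x y p \<otimes> lincomb x y q"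
  by (simp add: lincomb_def int_pow_mult m_ac)

lemma lincomb_0 [simp]: "lincomb x y 0 = \<one>"
  by (simp add: lincomb_def)

lemma lincomb_uminus:
  "x \<in> carrier G \<Longrightarrow> y \<in> carrier G \<Longrightarrow> lincomb x y (- p) = inv (lincomb x y p)"
  by (simp add: lincomb_def int_pow_neg inv_mult)

lemma lincomb_int_pow:
  "x \<in> carrier G \<Longrightarrow> y \<in> carrier G \<Longrightarrow> lincomb x y (a, b) [^] k = lincomb x y (a * k, b * k)"
  for k :: int
  by (simp add: lincomb_def int_pow_distrib int_pow_pow)

text \<open>A change of generators acts on exponents by an integer matrix.\<close>
lemma lincomb_lincomb:
  assumes "x \<in> carrier G" "y \<in> carrier G"
  shows "lincomb (lincomb x y (a, b)) (lincomb x y (c, d)) (k, l)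
           = lincomb x y (a * k + c * l, b * k + d * l)"
proof -
  have "lincomb (lincomb x y (a, b)) (lincomb x y (c, d)) (k, l)
      = lincomb x y (a, b) [^] k \<otimes> lincomb x y (c, d) [^] l"
    by (simp only: lincomb_def fst_conv snd_conv)
  also have "\<dots> = lincomb x y ((a * k, b * k) + (c * l, d * l))"
    by (simp only: lincomb_int_pow[OF assms] lincomb_add[OF assms])
  finally show ?thesis by simp
qed

section \<open>Pairs without a common root\<close>

text \<open>
  Dividing \<open>(a, b)\<close> by its gcd gives a primitive vector \<open>(a', b')\<close>, and Bezout's identity completes it
  to a basis of \<open>\<int> \<times> \<int>\<close>. The new generator \<open>v'\<close> belongs to the primitive vector, so its power with
  exponent \<open>gcd a b\<close> is the given relation, and the new pair still generates what the old one did.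
\<close>
lemma relation_to_torsion:
  fixes a b :: int
  assumes uv: "u \<in> carrier G" "v \<in> carrier G"
    and xy: "x \<in> range (lincomb u v)" "y \<in> range (lincomb u v)"
    and rel: "lincomb u v (a, b) = \<one>" and nz: "a \<noteq> 0 \<or> b \<noteq> 0"
  obtains u' v' where "u' \<in> carrier G" "v' \<in> carrier G"
    "x \<in> range (lincomb u' v')" "y \<in> range (lincomb u' v')" "v' [^] gcd a b = \<one>"
proof -
  define g where "g = gcd a b"
  have g: "g \<noteq> 0" using nz by (simp add: g_def)
  obtain a' b' where ab: "a = a' * g" "b = b' * g"
    unfolding g_def by (metis dvd_def gcd_dvd1 gcd_dvd2 mult.commute)
  obtain p q where "p * a + q * b = g"
    using bezout_int unfolding g_def by blast
  then have "g * (a' * p + b' * q) = g * 1"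
    by (simp add: ab algebra_simps)
  then have det: "a' * p + b' * q = 1"
    using g mult_cancel_left by blast
  define u' where "u' = lincomb u v (- q, p)"
  define v' where "v' = lincomb u v (a', b')"
  have cl: "u' \<in> carrier G" "v' \<in> carrier G"
    using uv by (simp_all add: u'_def v'_def)
  have inv_change: "lincomb u v (i, j) = lincomb u' v' (a' * j - b' * i, p * i + q * j)" for i j
  proof -
    \<comment> \<open>These are the two rows of the identity "matrix times adjugate equals determinant".\<close>
    have "- q * (a' * j - b' * i) + a' * (p * i + q * j) = (a' * p + b' * q) * i"
      "p * (a' * j - b' * i) + b' * (p * i + q * j) = (a' * p + b' * q) * j"
      by (simp_all add: algebra_simps)
    then show ?thesis
      unfolding u'_def v'_def lincomb_lincomb[OF uv] det by simp
  qed
  have "z \<in> range (lincomb u' v')" if mem: "z \<in> range (lincomb u v)" for z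
  proof -
    obtain i j where "z = lincomb u v (i, j)"
      using mem by (metis imageE surj_pair)
    then show ?thesis
      by (simp only: inv_change rangeI)
  qed
  moreover have "v' [^] g = \<one>"
    using rel unfolding v'_def lincomb_int_pow[OF uv] ab .
  ultimately show ?thesis
    using that cl xy by (simp add: g_def)
qed

text \<open>
  Local cyclicity for two elements, in a form that mentions exponents only. The root is an arbitrary
  element of the group, which makes the negation strong; that it can be chosen in the
  subgroup generated by the two elements is shown in \<open>common_root_in_span\<close>.
\<close>
definition common_roots :: bool where
  "common_roots \<longleftrightarrow> (\<forall>x\<in>carrier G. \<forall>y\<in>carrier G. \<exists>t\<in>carrier G. \<exists>(a::int) (b::int). x = t [^] a \<and> y = t [^] b)"

text \<open>
  Let \<open>d\<close> be the least positive exponent with \<open>v ^ d = 1\<close> for some pair \<open>(u, v)\<close> whose span contains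
  \<open>x\<close> and \<open>y\<close>. If there is none, then by \<open>relation_to_torsion\<close> the pair \<open>(x, y)\<close> itself is independent,
  which is the first alternative with \<open>m = 0\<close>. Otherwise the same lemma shows that every
  non-zero relation \<open>(a, b)\<close> of the minimal pair has \<open>gcd a b \<ge> d\<close>.
  Reducing \<open>b\<close> modulo \<open>d\<close> keeps a relation, and a non-zero remainder would bound the gcd
  below \<open>d\<close>; so \<open>d\<close> divides \<open>b\<close> and the relation splits into \<open>u ^ a = 1\<close> and \<open>v ^ b = 1\<close>. If \<open>u\<close> has finite
  order \<open>n\<close>, then \<open>(n, d)\<close> is a relation, so \<open>d\<close> divides \<open>n\<close>, and replacing \<open>u\<close> by its power with
  exponent \<open>n div d\<close> makes both orders equal to \<open>d\<close>.
\<close>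
lemma standard_pair_if_no_common_roots:
  assumes "\<not> common_roots"
  obtains (homogeneous) u v m where "u \<in> carrier G" "v \<in> carrier G" "m \<noteq> (1::int)" "m \<ge> 0"
      "\<And>a b. lincomb u v (a, b) = \<one> \<longleftrightarrow> m dvd a \<and> m dvd b"
  | (mixed) u v m where "u \<in> carrier G" "v \<in> carrier G" "m > (1::int)"
      "\<And>a b. lincomb u v (a, b) = \<one> \<longleftrightarrow> a = 0 \<and> m dvd b"
proof -
  obtain x y where xy: "x \<in> carrier G" "y \<in> carrier G"
    and no_root: "\<And>t a b. t \<in> carrier G \<Longrightarrow> x = t [^] (a::int) \<Longrightarrow> y \<noteq> t [^] (b::int)"
    using assms unfolding common_roots_def by blast
  define T where "T d \<longleftrightarrow> d > 0 \<and> (\<exists>u v. u \<in> carrier G \<and> v \<in> carrier G \<and>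
      x \<in> range (lincomb u v) \<and> y \<in> range (lincomb u v) \<and> v [^] int d = \<one>)" for d :: nat
  have T_gcd: "T (nat (gcd a b))"
    if "u \<in> carrier G" "v \<in> carrier G" "x \<in> range (lincomb u v)" "y \<in> range (lincomb u v)"
      "lincomb u v (a, b) = \<one>" "a \<noteq> 0 \<or> b \<noteq> 0" for u v a b
    using relation_to_torsion[OF that] that(6) unfolding T_def
    by (metis gcd_pos_int nat_0_le less_imp_le zero_less_nat_eq)
  show thesis
  proof (cases "\<exists>d. T d")
    case False
    have "x = lincomb x y (1, 0)" "y = lincomb x y (0, 1)"
      using xy by (simp_all add: lincomb_def)
    then have "x \<in> range (lincomb x y)" "y \<in> range (lincomb x y)"
      by (metis rangeI)+
    then have "lincomb x y (a, b) = \<one> \<Longrightarrow> a = 0 \<and> b = 0" for a b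
      using T_gcd[of x y a b] xy False by blast
    moreover have "lincomb x y (0, 0) = \<one>"
      by (simp add: lincomb_def)
    ultimately show thesis
      by (intro homogeneous[of x y 0]) (use xy in auto)
  next
    case True
    define d where "d = (LEAST d. T d)"
    have "T d" and least: "\<And>k. T k \<Longrightarrow> d \<le> k"
      using True unfolding d_def by (auto intro: LeastI Least_le)
    then obtain u v where uv: "u \<in> carrier G" "v \<in> carrier G"
      and span: "x \<in> range (lincomb u v)" "y \<in> range (lincomb u v)" and vd: "v [^] int d = \<one>" and d0: "d > 0"
      unfolding T_def by blast
    have gcd_ge: "int d \<le> gcd a b" if "lincomb u v (a, b) = \<one>" "a \<noteq> 0 \<or> b \<noteq> 0" for a b
      using least[OF T_gcd[OF uv span that]] by (simp add: le_nat_iff)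
    have v_pow: "v [^] b = \<one>" if "int d dvd b" for b
    proof -
      from that obtain k where "b = int d * k" by (rule dvdE)
      then have "v [^] b = (v [^] int d) [^] k"
        by (simp only: int_pow_pow[OF uv(2)])
      then show ?thesis
        by (simp only: vd int_pow_one)
    qed
    \<comment> \<open>Otherwise \<open>v\<close> is trivial and \<open>u\<close> is a common root.\<close>
    have d1: "d \<noteq> 1"
    proof
      assume "d = 1"
      then have v1: "v = \<one>" using vd uv by simp
      obtain p q where "x = lincomb u v p" "y = lincomb u v q" using span by blast
      then have "x = u [^] fst p" "y = u [^] fst q"
        using uv by (simp_all add: lincomb_def v1)
      then show False using no_root uv by blast
    qed
    have dvd_b: "int d dvd b" if rel: "lincomb u v (a, b) = \<one>" for a b
    proof (rule ccontr)
      assume nd: "\<not> int d dvd b"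
      have "v [^] b = v [^] (b mod int d + int d * (b div int d))"
        by simp
      also have "\<dots> = v [^] (b mod int d) \<otimes> v [^] (int d * (b div int d))"
        by (rule int_pow_mult[OF uv(2)])
      finally have "v [^] b = v [^] (b mod int d)"
        using uv v_pow by simp
      then have "lincomb u v (a, b mod int d) = \<one>"
        using rel by (simp add: lincomb_def)
      moreover have pos: "0 < b mod int d" "b mod int d < int d"
        using nd d0 pos_mod_sign[of "int d" b] pos_mod_bound[of "int d" b] mod_eq_0_iff_dvd[of b "int d"]
        by linarith+
      ultimately have "int d \<le> gcd a (b mod int d)"
        using gcd_ge by simp
      also have "\<dots> \<le> b mod int d"
        using pos by (intro zdvd_imp_le) auto
      finally show False using pos by simp
    qed
    have split: "int d dvd b \<and> u [^] a = \<one>" if rel: "lincomb u v (a, b) = \<one>" for a b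
      using dvd_b[OF rel] v_pow[of b] rel uv by (simp add: lincomb_def)
    \<comment> \<open>An element of infinite order has \<open>ord u = 0\<close>.\<close>
    show thesis
    proof (cases "ord u = 0")
      case True
      show thesis
      proof (rule mixed[of u v "int d"])
        show "lincomb u v (a, b) = \<one> \<longleftrightarrow> a = 0 \<and> int d dvd b" for a b
          using split[of a b] v_pow[of b] uv True int_pow_eq_id[of u a] by (auto simp: lincomb_def)
      qed (use uv d0 d1 in auto)
    next
      case False
      have "lincomb u v (int (ord u), int d) = \<one>"
        using uv vd by (simp add: lincomb_def int_pow_int)
      then have "int d \<le> gcd (int (ord u)) (int d)"
        using d0 by (intro gcd_ge) auto
      moreover have "gcd (int (ord u)) (int d) \<le> int d"
        using d0 by (intro zdvd_imp_le) auto
      ultimately have "int d dvd int (ord u)"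
        by (metis gcd_dvd1 order_antisym)
      then obtain n where n: "int (ord u) = int d * n" by (rule dvdE)
      then have n0: "n \<noteq> 0" using False by auto
      have u_pow: "u [^] (n * a) = \<one> \<longleftrightarrow> int d dvd a" for a
        using uv n0 by (simp add: int_pow_eq_id n mult.commute[of n])
      have comb: "lincomb (u [^] n) v (a, b) = lincomb u v (n * a, b)" for a b
        using uv by (simp add: lincomb_def int_pow_pow)
      show thesis
      proof (rule homogeneous[of "u [^] n" v "int d"])
        show "lincomb (u [^] n) v (a, b) = \<one> \<longleftrightarrow> int d dvd a \<and> int d dvd b" for a b
        proof
          assume "lincomb (u [^] n) v (a, b) = \<one>"
          then show "int d dvd a \<and> int d dvd b"
            using split[of "n * a" b] u_pow by (simp add: comb)
        next
          assume "int d dvd a \<and> int d dvd b"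
          then have "u [^] (n * a) = \<one>" "v [^] b = \<one>"
            using u_pow v_pow by blast+
          then show "lincomb (u [^] n) v (a, b) = \<one>"
            unfolding comb by (simp add: lincomb_def)
        qed
      qed (use uv d1 in auto)
    qed
  qed
qed

section \<open>Embedding finite lattices of exponent pairs\<close>

lemma lincomb_image_subgroup:
  assumes xy: "x \<in> carrier G" "y \<in> carrier G"
    and "0 \<in> A" "\<And>p q. p \<in> A \<Longrightarrow> q \<in> A \<Longrightarrow> p - q \<in> A"
  shows "subgroup (lincomb x y ` A) G"
proof (rule subgroupI)
  have neg: "- p \<in> A" if "p \<in> A" for p
    using assms(4)[OF assms(3) that] by simp
  show "inv a \<in> lincomb x y ` A" if "a \<in> lincomb x y ` A" for a
    using that neg lincomb_uminus[OF xy] by (metis (no_types, opaque_lifting) imageE imageI)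
  show "a \<otimes> b \<in> lincomb x y ` A" if "a \<in> lincomb x y ` A" "b \<in> lincomb x y ` A" for a b
  proof -
    obtain p q where pq: "p \<in> A" "q \<in> A" "a = lincomb x y p" "b = lincomb x y q"
      using \<open>a \<in> _\<close> \<open>b \<in> _\<close> by blast
    have "p - (- q) \<in> A"
      using pq neg assms(4) by blast
    then show ?thesis
      using pq by (simp flip: lincomb_add[OF xy])
  qed
qed (use assms in auto)

text \<open>
  Let \<open>A i\<close> be a family of subgroups of \<open>\<int> \<times> \<int>\<close> indexed by a lattice \<open>M\<close> such that meets of indices
  are intersections and joins of indices are sums. If the family has the relation lattice of \<open>x\<close> and \<open>y\<close> as
  its least member \<open>A z\<close>, then every \<open>A i\<close> is a union of cosets of the kernel of \<open>lincomb x y\<close>. By the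
  correspondence theorem its image determines it, so forming images preserves intersections as
  well as sums and gives a copy of \<open>M\<close>.
\<close>
lemma zero_sublattice_of_exponents:
  fixes A :: "'m \<Rightarrow> (int \<times> int) set" and M :: "'m gorder"
  assumes xy: "x \<in> carrier G" "y \<in> carrier G"
    and M: "lattice M" "carrier M = UNIV"
    and zero: "\<And>i. 0 \<in> A i" and diff: "\<And>i p q. p \<in> A i \<Longrightarrow> q \<in> A i \<Longrightarrow> p - q \<in> A i"
    and inj: "inj A"
    and meet: "\<And>i j. A (i \<sqinter>\<^bsub>M\<^esub> j) = A i \<inter> A j"
    and join: "\<And>i j p. p \<in> A (i \<squnion>\<^bsub>M\<^esub> j) \<Longrightarrow> \<exists>q\<in>A i. p - q \<in> A j"
    and ker: "\<And>p. lincomb x y p = \<one> \<longleftrightarrow> p \<in> A z" and z: "\<And>i. A z \<subseteq> A i"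
  shows "\<exists>S. zero_sublattice (subgroup_lattice G) S \<and>
             lattice_isomorphic ((subgroup_lattice G)\<lparr>carrier := S\<rparr>) M"
proof -
  interpret L: lattice "subgroup_lattice G" by (rule subgroup_lattice_lattice)
  interpret M: lattice M by (rule M)
  define f where "f i = lincomb x y ` A i" for i
  have sub: "subgroup (f i) G" for i
    unfolding f_def using xy zero diff by (intro lincomb_image_subgroup)
  have f_carrier: "f i \<in> carrier (subgroup_lattice G)" for i
    using sub by (simp add: subgroup_lattice_def)
  \<comment> \<open>The correspondence theorem: \<open>A i\<close> is the full preimage of its image.\<close>
  have f_iff: "lincomb x y p \<in> f i \<longleftrightarrow> p \<in> A i" for p i
  proof
    assume "lincomb x y p \<in> f i"
    then obtain q where q: "q \<in> A i" "lincomb x y p = lincomb x y q"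
      by (auto simp: f_def)
    have "lincomb x y (q - p) = \<one>"
      using xy q(2) lincomb_add[of x y q "- p"] by (simp add: lincomb_uminus)
    then have "q - p \<in> A i" using ker z by blast
    then have "q - (q - p) \<in> A i" using q diff by blast
    then show "p \<in> A i" by simp
  qed (simp add: f_def)
  have f_meet: "f (i \<sqinter>\<^bsub>M\<^esub> j) = f i \<sqinter>\<^bsub>subgroup_lattice G\<^esub> f j" for i j
  proof -
    have "f (i \<sqinter>\<^bsub>M\<^esub> j) = f i \<inter> f j"
    proof
      show "f i \<inter> f j \<subseteq> f (i \<sqinter>\<^bsub>M\<^esub> j)"
      proof
        fix g assume g: "g \<in> f i \<inter> f j"
        then obtain p where "g = lincomb x y p" by (auto simp: f_def)
        then show "g \<in> f (i \<sqinter>\<^bsub>M\<^esub> j)"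
          using g by (simp add: f_iff meet)
      qed
    qed (auto simp: f_def meet)
    then show ?thesis by (simp add: subgroup_lattice_meet sub)
  qed
  have mono: "A i \<subseteq> A j" if "i \<sqsubseteq>\<^bsub>M\<^esub> j" for i j
    using meet[of i j] M.le_iff_join[of i j] that M(2) by auto
  have f_join: "f i \<squnion>\<^bsub>subgroup_lattice G\<^esub> f j = f (i \<squnion>\<^bsub>M\<^esub> j)" for i j
  proof (rule L.join_eqI[OF f_carrier f_carrier f_carrier])
    show "f i \<sqsubseteq>\<^bsub>subgroup_lattice G\<^esub> f (i \<squnion>\<^bsub>M\<^esub> j)" "f j \<sqsubseteq>\<^bsub>subgroup_lattice G\<^esub> f (i \<squnion>\<^bsub>M\<^esub> j)"
      using mono[OF M.join_left[of i j]] mono[OF M.join_right[of i j]] M(2)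
      by (auto simp: subgroup_lattice_def f_def)
    fix H assume "H \<in> carrier (subgroup_lattice G)" "f i \<sqsubseteq>\<^bsub>subgroup_lattice G\<^esub> H" "f j \<sqsubseteq>\<^bsub>subgroup_lattice G\<^esub> H"
    then have H: "subgroup H G" "f i \<subseteq> H" "f j \<subseteq> H"
      by (auto simp: subgroup_lattice_def)
    have "lincomb x y p \<in> H" if "p \<in> A (i \<squnion>\<^bsub>M\<^esub> j)" for p
    proof -
      from join[OF that] obtain q where q: "q \<in> A i" "p - q \<in> A j" by blast
      then have "lincomb x y q \<in> H" "lincomb x y (p - q) \<in> H"
        using H by (auto simp: f_def)
      then have "lincomb x y q \<otimes> lincomb x y (p - q) \<in> H"
        by (rule subgroup.m_closed[OF H(1)])
      then show ?thesis
        using lincomb_add[OF xy, of q "p - q"] by simp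
    qed
    then show "f (i \<squnion>\<^bsub>M\<^esub> j) \<sqsubseteq>\<^bsub>subgroup_lattice G\<^esub> H"
      by (auto simp: subgroup_lattice_def f_def)
  qed
  have f_inj: "inj f"
  proof (rule injI)
    fix i j assume "f i = f j"
    then have "A i = A j" using f_iff by blast
    then show "i = j" using inj by (simp add: inj_def)
  qed
  have "f z = {\<one>}"
    using imageI[OF zero[of z], of "lincomb x y"] ker by (auto simp: f_def)
  then have zs: "zero_sublattice (subgroup_lattice G) (range f)"
    unfolding zero_sublattice_def
    using f_carrier subgroup_lattice_bottom by (auto simp: f_join simp flip: f_meet)
  have S: "lattice ((subgroup_lattice G)\<lparr>carrier := range f\<rparr>)"
    and sj: "f i \<squnion>\<^bsub>(subgroup_lattice G)\<lparr>carrier := range f\<rparr>\<^esub> f j = f (i \<squnion>\<^bsub>M\<^esub> j)"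
    and sm: "f i \<sqinter>\<^bsub>(subgroup_lattice G)\<lparr>carrier := range f\<rparr>\<^esub> f j = f (i \<sqinter>\<^bsub>M\<^esub> j)" for i j
    using L.sublattice[of "range f"] zs unfolding zero_sublattice_def
    by (auto simp: f_join f_meet)
  have "lattice_isomorphic ((subgroup_lattice G)\<lparr>carrier := range f\<rparr>) M"
    unfolding lattice_isomorphic_def join_pres_def meet_pres_def
    using S M f_inj
    by (intro exI[of _ "inv_into UNIV f"])
      (auto simp: sj sm inv_f_f bij_betw_inv_into bij_betw_def inj_on_inv_into)
  then show ?thesis using zs by blast
qed

end

text \<open>
  In \<open>\<int>_m \<times> \<int>_m\<close> these are zero, the two axes, the diagonal and the whole group. For \<open>m = 0\<close> they
  are the corresponding subgroups of \<open>\<int> \<times> \<int>\<close>.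
\<close>
primrec M3_exponents :: "int \<Rightarrow> m3 \<Rightarrow> (int \<times> int) set" where
  "M3_exponents m M3_0 = {(a, b). m dvd a \<and> m dvd b}"
| "M3_exponents m M3_a = {(a, b). m dvd b}"
| "M3_exponents m M3_b = {(a, b). m dvd a}"
| "M3_exponents m M3_c = {(a, b). m dvd a - b}"
| "M3_exponents m M3_1 = UNIV"

text \<open>
  In \<open>\<int> \<times> \<int>_m\<close> the member at \<open>M23_c\<close> is the torsion subgroup, those at \<open>M23_a\<close> and \<open>M23_b\<close> are the cyclic
  groups generated by \<open>(1, 0)\<close> and \<open>(1, 1)\<close>, the one at \<open>M23_d\<close> is generated by \<open>(m, 0)\<close>, and
  the one at \<open>M23_f\<close> is the sum of the members at \<open>M23_c\<close> and \<open>M23_d\<close>.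
\<close>
primrec M23_exponents :: "int \<Rightarrow> m23 \<Rightarrow> (int \<times> int) set" where
  "M23_exponents m M23_0 = {(a, b). a = 0 \<and> m dvd b}"
| "M23_exponents m M23_d = {(a, b). m dvd a \<and> m dvd b}"
| "M23_exponents m M23_c = {(a, b). a = 0}"
| "M23_exponents m M23_a = {(a, b). m dvd b}"
| "M23_exponents m M23_b = {(a, b). m dvd a - b}"
| "M23_exponents m M23_f = {(a, b). m dvd a}"
| "M23_exponents m M23_1 = UNIV"

lemma dvd_diff_diff: "m dvd a - b \<Longrightarrow> m dvd c - d \<Longrightarrow> m dvd a - c - (b - d)" for m :: int
  using dvd_diff[of m "a - b" "c - d"] by (simp add: algebra_simps)

lemma dvd_diff_cases:
  fixes m :: int
  shows "m dvd a \<Longrightarrow> m dvd a - b \<Longrightarrow> m dvd b"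
    and "m dvd b \<Longrightarrow> m dvd a - b \<Longrightarrow> m dvd a"
  by (metis dvd_diff diff_diff_eq2 add_diff_cancel_left', metis dvd_add diff_add_cancel)

text \<open>
  For the two injectivity lemmas it is enough to test membership of a few vectors that separate any
  two of the subgroups.
\<close>
lemma inj_M3_exponents:
  assumes "m \<noteq> 1" "m \<ge> 0" shows "inj (M3_exponents m)"
proof (rule injI)
  fix i j assume eq: "M3_exponents m i = M3_exponents m j"
  have "\<not> m dvd 1" using assms by simp
  then have "i = j \<or> ((1,0) \<in> M3_exponents m i \<longleftrightarrow> (1,0) \<notin> M3_exponents m j)
     \<or> ((0,1) \<in> M3_exponents m i \<longleftrightarrow> (0,1) \<notin> M3_exponents m j)
     \<or> ((1,1) \<in> M3_exponents m i \<longleftrightarrow> (1,1) \<notin> M3_exponents m j)"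
    by (cases i; cases j) auto
  then show "i = j" using eq by simp
qed

lemma inj_M23_exponents:
  assumes "m > 1" shows "inj (M23_exponents m)"
proof (rule injI)
  fix i j assume eq: "M23_exponents m i = M23_exponents m j"
  have "\<not> m dvd 1" using assms by simp
  then have "i = j \<or> ((1,0) \<in> M23_exponents m i \<longleftrightarrow> (1,0) \<notin> M23_exponents m j)
     \<or> ((0,1) \<in> M23_exponents m i \<longleftrightarrow> (0,1) \<notin> M23_exponents m j)
     \<or> ((1,1) \<in> M23_exponents m i \<longleftrightarrow> (1,1) \<notin> M23_exponents m j)
     \<or> ((m,0) \<in> M23_exponents m i \<longleftrightarrow> (m,0) \<notin> M23_exponents m j)"
    using assms by (cases i; cases j) auto
  then show "i = j" using eq by simp
qed

lemma zero_mem_M3_exponents: "0 \<in> M3_exponents m i"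
  by (cases i) (simp_all add: zero_prod_def)

lemma zero_mem_M23_exponents: "0 \<in> M23_exponents m i"
  by (cases i) (simp_all add: zero_prod_def)

text \<open>
  For incomparable indices, a summand is found by projecting \<open>(a, b)\<close> to one of the axes or to the
  diagonal, along another of these lines; six candidate vectors cover all such pairs.
\<close>
lemma M3_exponents_join:
  assumes "(a, b) \<in> M3_exponents m (i \<squnion>\<^bsub>M3\<^esub> j)"
  shows "\<exists>q\<in>M3_exponents m i. (a, b) - q \<in> M3_exponents m j"
proof -
  consider "i \<sqsubseteq>\<^bsub>M3\<^esub> j" | "j \<sqsubseteq>\<^bsub>M3\<^esub> i" | "\<not> i \<sqsubseteq>\<^bsub>M3\<^esub> j" "\<not> j \<sqsubseteq>\<^bsub>M3\<^esub> i"
    by blast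
  then show ?thesis
  proof cases
    case 1
    then show ?thesis
      using assms zero_mem_M3_exponents[of m i] by (intro bexI[of _ 0]) (simp_all add: M3_join)
  next
    case 2
    then have "M3_exponents m (i \<squnion>\<^bsub>M3\<^esub> j) = M3_exponents m i"
      using lattice.join_eqI[OF M3_lattice, of i j i] by (simp add: M3_le_iff)
    then show ?thesis
      using assms zero_mem_M3_exponents[of m j] by (intro bexI[of _ "(a, b)"]) (simp_all add: zero_prod_def)
  next
    case 3
    let ?ok = "\<lambda>q. q \<in> M3_exponents m i \<and> (a, b) - q \<in> M3_exponents m j"
    have "?ok (a, 0) \<or> ?ok (0, b) \<or> ?ok (a - b, 0) \<or> ?ok (0, b - a) \<or> ?ok (a, a) \<or> ?ok (b, b)"
      using assms 3 by (cases i; cases j) (simp_all add: M3_join M3_le_iff)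
    then show ?thesis by blast
  qed
qed

lemma M23_exponents_join:
  assumes "(a, b) \<in> M23_exponents m (i \<squnion>\<^bsub>M23\<^esub> j)"
  shows "\<exists>q\<in>M23_exponents m i. (a, b) - q \<in> M23_exponents m j"
proof -
  consider "i \<sqsubseteq>\<^bsub>M23\<^esub> j" | "j \<sqsubseteq>\<^bsub>M23\<^esub> i" | "\<not> i \<sqsubseteq>\<^bsub>M23\<^esub> j" "\<not> j \<sqsubseteq>\<^bsub>M23\<^esub> i"
    by blast
  then show ?thesis
  proof cases
    case 1
    then show ?thesis
      using assms zero_mem_M23_exponents[of m i] by (intro bexI[of _ 0]) (simp_all add: M23_join)
  next
    case 2
    then have "M23_exponents m (i \<squnion>\<^bsub>M23\<^esub> j) = M23_exponents m i"
      using lattice.join_eqI[OF M23_lattice, of i j i] by (simp add: M23_le_iff)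
    then show ?thesis
      using assms zero_mem_M23_exponents[of m j] by (intro bexI[of _ "(a, b)"]) (simp_all add: zero_prod_def)
  next
    case 3
    let ?ok = "\<lambda>q. q \<in> M23_exponents m i \<and> (a, b) - q \<in> M23_exponents m j"
    have "?ok (a, 0) \<or> ?ok (0, b) \<or> ?ok (a - b, 0) \<or> ?ok (0, b - a) \<or> ?ok (a, a) \<or> ?ok (b, b)"
      using assms 3 by (cases i; cases j) (simp_all add: M23_join M23_le_iff doubleton_eq_iff)
    then show ?thesis by blast
  qed
qed

lemma M3_exponents_meet: "M3_exponents m (i \<sqinter>\<^bsub>M3\<^esub> j) = M3_exponents m i \<inter> M3_exponents m j"
  by (cases i; cases j) (auto simp: M3_meet M3_le_iff intro: dvd_diff dvd_diff_cases)

lemma M23_exponents_meet: "M23_exponents m (i \<sqinter>\<^bsub>M23\<^esub> j) = M23_exponents m i \<inter> M23_exponents m j"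
  by (cases i; cases j) (auto simp: M23_meet M23_le_iff intro: dvd_diff dvd_diff_cases)

context comm_group
begin

lemma forbidden_sublattice_if_no_common_roots:
  assumes "\<not> common_roots"
  shows "\<exists>S. zero_sublattice (subgroup_lattice G) S \<and>
               (lattice_isomorphic ((subgroup_lattice G)\<lparr>carrier := S\<rparr>) M3 \<or>
                lattice_isomorphic ((subgroup_lattice G)\<lparr>carrier := S\<rparr>) M23)"
  using assms
proof (cases rule: standard_pair_if_no_common_roots)
  case (homogeneous u v m)
  have "\<exists>S. zero_sublattice (subgroup_lattice G) S \<and>
            lattice_isomorphic ((subgroup_lattice G)\<lparr>carrier := S\<rparr>) M3"
  proof (rule zero_sublattice_of_exponents[where A = "M3_exponents m" and z = M3_0])
    show "0 \<in> M3_exponents m i" for i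
      by (rule zero_mem_M3_exponents)
    show "p - q \<in> M3_exponents m i" if "p \<in> M3_exponents m i" "q \<in> M3_exponents m i" for i p q
      using that by (cases i) (auto simp: dvd_diff_diff)
    show "\<exists>q\<in>M3_exponents m i. p - q \<in> M3_exponents m j" if "p \<in> M3_exponents m (i \<squnion>\<^bsub>M3\<^esub> j)" for i j p
      using M3_exponents_join that by (cases p) simp
    show "lincomb u v p = \<one> \<longleftrightarrow> p \<in> M3_exponents m M3_0" for p
      using homogeneous(5) by (cases p) simp
    show "M3_exponents m M3_0 \<subseteq> M3_exponents m i" for i
      by (cases i) auto
  qed (use homogeneous in \<open>auto intro: M3_lattice inj_M3_exponents simp: M3_exponents_meet\<close>)
  then show ?thesis by blast
next
  case (mixed u v m)
  have "\<exists>S. zero_sublattice (subgroup_lattice G) S \<and>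
            lattice_isomorphic ((subgroup_lattice G)\<lparr>carrier := S\<rparr>) M23"
  proof (rule zero_sublattice_of_exponents[where A = "M23_exponents m" and z = M23_0])
    show "0 \<in> M23_exponents m i" for i
      by (rule zero_mem_M23_exponents)
    show "p - q \<in> M23_exponents m i" if "p \<in> M23_exponents m i" "q \<in> M23_exponents m i" for i p q
      using that by (cases i) (auto simp: dvd_diff_diff)
    show "\<exists>q\<in>M23_exponents m i. p - q \<in> M23_exponents m j" if "p \<in> M23_exponents m (i \<squnion>\<^bsub>M23\<^esub> j)" for i j p
      using M23_exponents_join that by (cases p) simp
    show "lincomb u v p = \<one> \<longleftrightarrow> p \<in> M23_exponents m M23_0" for p
      using mixed(4) by (cases p) simp
    show "M23_exponents m M23_0 \<subseteq> M23_exponents m i" for i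
      by (cases i) auto
  qed (use mixed in \<open>auto intro: M23_lattice inj_M23_exponents simp: M23_exponents_meet\<close>)
  then show ?thesis by blast
qed

section \<open>Common roots, local cyclicity and distributivity\<close>

text \<open>
  If \<open>x\<close> and \<open>y\<close> are the powers of \<open>t\<close> with exponents \<open>a\<close> and \<open>b\<close>, then they are powers of
  \<open>t ^ gcd a b\<close>, and Bezout's identity writes this element as a combination of \<open>x\<close> and \<open>y\<close>.
\<close>
lemma common_root_in_span:
  assumes cr: common_roots and xy: "x \<in> carrier G" "y \<in> carrier G"
  obtains a b :: int and p where
    "x = lincomb x y p [^] a" "y = lincomb x y p [^] b"
proof -
  obtain t and a b :: int where t: "t \<in> carrier G" "x = t [^] a" "y = t [^] b"
    using cr xy unfolding common_roots_def by blast
  define g where "g = gcd a b"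
  obtain i j where "i * a + j * b = g"
    using bezout_int unfolding g_def by blast
  then have g: "g = a * i + b * j" by (simp add: mult.commute)
  obtain a' b' where ab: "a = g * a'" "b = g * b'"
    unfolding g_def by (meson dvdE gcd_dvd1 gcd_dvd2)
  have tg: "lincomb x y (i, j) = t [^] g"
    using t(1) by (simp add: lincomb_def t(2,3) int_pow_pow flip: int_pow_mult g)
  show thesis
  proof (rule that)
    show "x = lincomb x y (i, j) [^] a'" "y = lincomb x y (i, j) [^] b'"
      using t(1) unfolding tg by (simp_all add: t(2,3) int_pow_pow flip: ab)
  qed
qed

lemma lincomb_mem:
  assumes "subgroup H G" "x \<in> H" "y \<in> H" shows "lincomb x y p \<in> H"
  unfolding lincomb_def by (intro subgroup.m_closed[OF assms(1)] subgroup_int_pow_closed assms)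

text \<open>
  From right to left, a generator of a finitely generated subgroup is built by adding one element
  at a time. The root has to lie in the subgroup generated so far, so that at the end it generates exactly
  that subgroup.
\<close>
lemma locally_cyclic_iff_common_roots: "locally_cyclic G \<longleftrightarrow> common_roots"
proof
  assume lc: "locally_cyclic G"
  show common_roots
    unfolding common_roots_def
  proof (intro ballI)
    fix x y assume xy: "x \<in> carrier G" "y \<in> carrier G"
    let ?H = "subgroup_generated G {x, y}"
    interpret H: group ?H by simp
    have "cyclic_group ?H"
      using lc xy unfolding locally_cyclic_def by simp
    then obtain t where t: "t \<in> carrier ?H" "carrier ?H = range (\<lambda>n::int. t [^]\<^bsub>?H\<^esub> n)"
      using H.cyclic_group by blast
    have "{x, y} \<subseteq> carrier ?H"
      using xy by (intro subgroup_generated_subset_carrier_subset) auto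
    then have "{x, y} \<subseteq> range (\<lambda>n::int. t [^] n)"
      using t int_pow_subgroup_generated[OF t(1)] by simp
    moreover have "t \<in> carrier G"
      using t(1) carrier_subgroup_generated_subset by blast
    ultimately show "\<exists>t\<in>carrier G. \<exists>(a::int) (b::int). x = t [^] a \<and> y = t [^] b"
      by auto
  qed
next
  assume cr: common_roots
  have root: "\<exists>t\<in>generate G A. \<forall>x\<in>A. \<exists>n::int. x = t [^] n" if "finite A" "A \<subseteq> carrier G" for A
    using that
  proof (induction A rule: finite_induct)
    case empty
    show ?case using generate.one by blast
  next
    case (insert y A)
    then obtain t where t: "t \<in> generate G A" "\<And>x. x \<in> A \<Longrightarrow> \<exists>n::int. x = t [^] n"
      by auto
    have y: "y \<in> carrier G" and tG: "t \<in> carrier G"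
      using insert.prems generate_in_carrier t(1) by auto
    obtain a b p where s: "t = lincomb t y p [^] (a::int)" "y = lincomb t y p [^] (b::int)"
      using common_root_in_span[OF cr tG y] .
    define s where "s = lincomb t y p"
    have sG: "s \<in> carrier G" using tG y by (simp add: s_def)
    have ts: "t = s [^] a" and ys: "y = s [^] b"
      using s by (simp_all add: s_def)
    have "\<exists>n::int. x = s [^] n" if mem: "x \<in> insert y A" for x
    proof (cases "x = y")
      case True
      then show ?thesis using ys by blast
    next
      case False
      then obtain n :: int where "x = t [^] n"
        using t(2) mem by blast
      then have "x = s [^] (a * n)"
        by (simp only: ts int_pow_pow[OF sG])
      then show ?thesis by blast
    qed
    moreover have "s \<in> generate G (insert y A)"
      unfolding s_def
    proof (rule lincomb_mem)
      show "subgroup (generate G (insert y A)) G"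
        using insert.prems by (rule generate_is_subgroup)
      show "t \<in> generate G (insert y A)"
        using t(1) mono_generate[of A "insert y A"] by blast
    qed (simp add: generate.incl)
    ultimately show ?case by blast
  qed
  show "locally_cyclic G"
    unfolding locally_cyclic_def
  proof (intro allI impI, elim conjE)
    fix A assume A: "finite A" "A \<subseteq> carrier G"
    obtain t where t: "t \<in> generate G A" "\<And>x. x \<in> A \<Longrightarrow> \<exists>n::int. x = t [^] n"
      using root[OF A] by blast
    have tG: "t \<in> carrier G" using generate_in_carrier A t(1) by blast
    have sub: "subgroup (generate G A) G" "subgroup (generate G {t}) G"
      using A tG by (auto intro: generate_is_subgroup)
    have "A \<subseteq> generate G {t}"
      using t(2) generate_pow[OF tG] by blast
    then have "generate G A = generate G {t}"
      using t(1) sub by (intro subset_antisym generate_subgroup_incl) auto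
    then have "subgroup_generated G A = subgroup_generated G {t}"
      using A tG by (simp add: subgroup_generated_def Int_absorb1)
    then show "cyclic_group (subgroup_generated G A)"
      by (simp add: cyclic_group_generated)
  qed
qed

lemma subgroup_lattice_join_set_mult:
  assumes "subgroup H G" "subgroup K G"
  shows "H \<squnion>\<^bsub>subgroup_lattice G\<^esub> K = H <#> K"
proof -
  interpret L: lattice "subgroup_lattice G" by (rule subgroup_lattice_lattice)
  have "H \<subseteq> H <#> K" "K \<subseteq> H <#> K"
    using assms subgroup.one_closed subgroup.mem_carrier unfolding set_mult_def
    by (force, force)
  then show ?thesis
    using assms mult_subgroups[OF assms]
    by (intro L.join_eqI) (auto simp: subgroup_lattice_def set_mult_def dest: subgroup.m_closed)
qed

text \<open>
  Let \<open>u = v w\<close> with \<open>v = t ^ a\<close> and \<open>w = t ^ b\<close>, where the root is \<open>t = v ^ i w ^ j\<close>. Then the exponent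
  \<open>a i + b j\<close> acts as the identity on \<open>t\<close>, hence on \<open>u = t ^ (a + b)\<close>, so \<open>u = (u ^ a) ^ i (u ^ b) ^ j\<close>.
  Moreover \<open>u ^ a = v ^ (a + b)\<close> lies in \<open>V\<close> and \<open>u ^ b = w ^ (a + b)\<close> lies in \<open>W\<close>.
\<close>
lemma distributive_if_common_roots:
  assumes cr: common_roots
  shows "distributive_lattice (subgroup_lattice G)"
  unfolding distributive_lattice_def
proof (intro conjI ballI subgroup_lattice_lattice)
  fix U V W assume "U \<in> carrier (subgroup_lattice G)" "V \<in> carrier (subgroup_lattice G)"
    "W \<in> carrier (subgroup_lattice G)"
  then have sub: "subgroup U G" "subgroup V G" "subgroup W G"
    by (auto simp: subgroup_lattice_def)
  note int = subgroups_Inter_pair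
  have "U \<inter> (V <#> W) = (U \<inter> V) <#> (U \<inter> W)"
  proof
    show "(U \<inter> V) <#> (U \<inter> W) \<subseteq> U \<inter> (V <#> W)"
      using sub by (auto simp: set_mult_def dest: subgroup.m_closed)
    show "U \<inter> (V <#> W) \<subseteq> (U \<inter> V) <#> (U \<inter> W)"
    proof
      fix u assume "u \<in> U \<inter> (V <#> W)"
      then obtain v w where u: "u \<in> U" "u = v \<otimes> w" and vw: "v \<in> V" "w \<in> W"
        by (auto simp: set_mult_def)
      have G: "v \<in> carrier G" "w \<in> carrier G"
        using vw subgroup.mem_carrier[OF sub(2)] subgroup.mem_carrier[OF sub(3)] by auto
      obtain a b p where p: "v = lincomb v w p [^] (a::int)" "w = lincomb v w p [^] (b::int)"
        using common_root_in_span[OF cr G] .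
      define t where "t = lincomb v w p"
      obtain i j where ij: "p = (i, j)" by (cases p)
      have tG: "t \<in> carrier G" using G by (simp add: t_def)
      have va: "v = t [^] a" and wb: "w = t [^] b"
        using p by (simp_all add: t_def)
      have ut: "u = t [^] (a + b)"
        using u(2) tG by (simp add: int_pow_mult va wb)
      have "t = v [^] i \<otimes> w [^] j"
        by (simp add: t_def ij lincomb_def)
      also have "\<dots> = t [^] (a * i + b * j)"
        by (simp only: va wb int_pow_pow[OF tG] int_pow_mult[OF tG])
      finally have "u = (t [^] (a * i + b * j)) [^] (a + b)"
        using ut by simp
      also have "\<dots> = t [^] ((a + b) * (a * i) + (a + b) * (b * j))"
        unfolding int_pow_pow[OF tG] by (simp add: algebra_simps)
      also have "\<dots> = u [^] (a * i) \<otimes> u [^] (b * j)"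
        unfolding ut int_pow_pow[OF tG] by (rule int_pow_mult[OF tG])
      finally have eq: "u = u [^] (a * i) \<otimes> u [^] (b * j)" .
      have "u [^] (a * i) = v [^] ((a + b) * i)"
        unfolding ut va int_pow_pow[OF tG] by (simp add: algebra_simps)
      moreover have "u [^] (b * j) = w [^] ((a + b) * j)"
        unfolding ut wb int_pow_pow[OF tG] by (simp add: algebra_simps)
      ultimately have "u [^] (a * i) \<in> U \<inter> V" "u [^] (b * j) \<in> U \<inter> W"
        using subgroup_int_pow_closed[OF sub(1) u(1)]
          subgroup_int_pow_closed[OF sub(2) vw(1)] subgroup_int_pow_closed[OF sub(3) vw(2)]
        by (metis IntI)+
      then show "u \<in> (U \<inter> V) <#> (U \<inter> W)"
        using eq by (auto simp: set_mult_def)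
    qed
  qed
  then show "U \<sqinter>\<^bsub>subgroup_lattice G\<^esub> (V \<squnion>\<^bsub>subgroup_lattice G\<^esub> W)
      = (U \<sqinter>\<^bsub>subgroup_lattice G\<^esub> V) \<squnion>\<^bsub>subgroup_lattice G\<^esub> (U \<sqinter>\<^bsub>subgroup_lattice G\<^esub> W)"
    using sub by (simp add: subgroup_lattice_join_set_mult subgroup_lattice_meet int mult_subgroups)
qed

text \<open>
  By distributivity, the set \<open>D\<close> of all subgroups that meet \<open>W\<close> trivially is closed under joins. It is
  therefore directed, so its union is a subgroup, and this union still meets \<open>W\<close> trivially.
\<close>
lemma pseudocomplemented_if_distributive:
  assumes "distributive_lattice (subgroup_lattice G)"
  shows "pseudocomplemented (subgroup_lattice G)"
  unfolding pseudocomplemented_def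
proof
  fix W assume "W \<in> carrier (subgroup_lattice G)"
  then have W: "subgroup W G" by (simp add: subgroup_lattice_def)
  have dist: "X \<sqinter>\<^bsub>subgroup_lattice G\<^esub> (Y \<squnion>\<^bsub>subgroup_lattice G\<^esub> Z)
      = (X \<sqinter>\<^bsub>subgroup_lattice G\<^esub> Y) \<squnion>\<^bsub>subgroup_lattice G\<^esub> (X \<sqinter>\<^bsub>subgroup_lattice G\<^esub> Z)"
    if "subgroup X G" "subgroup Y G" "subgroup Z G" for X Y Z
  proof -
    have "X \<in> carrier (subgroup_lattice G)" "Y \<in> carrier (subgroup_lattice G)"
      "Z \<in> carrier (subgroup_lattice G)"
      using that by (simp_all add: subgroup_lattice_def)
    then show ?thesis
      using assms unfolding distributive_lattice_def by blast
  qed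
  define D where "D = {H. subgroup H G \<and> W \<inter> H = {\<one>}}"
  have D_join: "H <#> K \<in> D" if "H \<in> D" "K \<in> D" for H K
  proof -
    have HK: "subgroup H G" "subgroup K G" and disj: "W \<inter> H = {\<one>}" "W \<inter> K = {\<one>}"
      using that by (auto simp: D_def)
    have "W \<inter> (H <#> K) = (W \<inter> H) <#> (W \<inter> K)"
      using dist[OF W HK] W HK
      by (simp add: subgroup_lattice_join_set_mult subgroup_lattice_meet subgroups_Inter_pair mult_subgroups)
    also have "\<dots> = {\<one>}"
      by (simp add: disj set_mult_def)
    finally show ?thesis
      using HK mult_subgroups by (simp add: D_def)
  qed
  have "{\<one>} \<in> D"
    using W triv_subgroup subgroup.one_closed by (auto simp: D_def)
  have "subgroup (\<Union>D) G"
  proof (rule subgroupI)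
    show "\<Union>D \<subseteq> carrier G"
      by (auto simp: D_def dest: subgroup.mem_carrier)
    show "\<Union>D \<noteq> {}" using \<open>{\<one>} \<in> D\<close> by blast
    show "inv g \<in> \<Union>D" if "g \<in> \<Union>D" for g
      using that by (auto simp: D_def dest: subgroup.m_inv_closed)
    show "g \<otimes> h \<in> \<Union>D" if gh: "g \<in> \<Union>D" "h \<in> \<Union>D" for g h
    proof -
      obtain H K where HK: "H \<in> D" "K \<in> D" "g \<in> H" "h \<in> K"
        using gh by blast
      then have "g \<otimes> h \<in> H <#> K"
        by (auto simp: set_mult_def)
      then show ?thesis
        using D_join HK by blast
    qed
  qed
  moreover have "W \<inter> \<Union>D = (\<Union>H\<in>D. W \<inter> H)"
    by blast
  then have "W \<inter> \<Union>D = {\<one>}"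
    using \<open>{\<one>} \<in> D\<close> by (auto simp: D_def)
  moreover have "X \<subseteq> \<Union>D" if "subgroup X G" "W \<inter> X = {\<one>}" for X
    using that by (auto simp: D_def)
  moreover have carrier: "X \<in> carrier (subgroup_lattice G) \<longleftrightarrow> subgroup X G" for X
    by (simp add: subgroup_lattice_def)
  moreover have le: "X \<sqsubseteq>\<^bsub>subgroup_lattice G\<^esub> Y \<longleftrightarrow> X \<subseteq> Y" for X Y
    by (simp add: subgroup_lattice_def)
  ultimately have "is_pseudocomplement (subgroup_lattice G) W (\<Union>D)"
    unfolding is_pseudocomplement_def carrier le
    using W by (simp add: subgroup_lattice_meet subgroup_lattice_bottom Ball_def carrier)
  then show "\<exists>S. is_pseudocomplement (subgroup_lattice G) W S" by blast
qed

lemma entangled_subgroup_lattice_iff: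
  "entangled (subgroup_lattice G) U V W \<longleftrightarrow>
     subgroup U G \<and> subgroup V G \<and> subgroup W G \<and>
     U \<noteq> {\<one>} \<and> V \<noteq> {\<one>} \<and> W \<noteq> {\<one>} \<and>
     U \<inter> W = {\<one>} \<and> V \<inter> W = {\<one>} \<and>
     U \<squnion>\<^bsub>subgroup_lattice G\<^esub> V = U \<squnion>\<^bsub>subgroup_lattice G\<^esub> W \<and>
     U \<squnion>\<^bsub>subgroup_lattice G\<^esub> W = V \<squnion>\<^bsub>subgroup_lattice G\<^esub> W"
proof -
  have "U \<in> carrier (subgroup_lattice G) \<longleftrightarrow> subgroup U G" for U
    by (simp add: subgroup_lattice_def)
  then show ?thesis
    unfolding entangled_def subgroup_lattice_bottom
    by (simp add: subgroup_lattice_meet cong: conj_cong)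
qed

lemma subgroup_lattice_bounded: "bounded_lattice (subgroup_lattice G)"
proof -
  interpret L: complete_lattice "subgroup_lattice G" by (rule subgroup_lattice_complete)
  show ?thesis by unfold_locales
qed

end

theorem theorem2p7:
  fixes G :: "('a, 'b) monoid_scheme" (structure)
  assumes "comm_group G"
  shows
    "(distributive_lattice (subgroup_lattice G) \<longleftrightarrow> locally_cyclic G) \<and>
     (distributive_lattice (subgroup_lattice G) \<longleftrightarrow> pseudocomplemented (subgroup_lattice G)) \<and>
     (distributive_lattice (subgroup_lattice G) \<longleftrightarrow>
        \<not> (\<exists>S. zero_sublattice (subgroup_lattice G) S \<and>
               (lattice_isomorphic ((subgroup_lattice G)\<lparr>carrier := S\<rparr>) M3 \<or>
                lattice_isomorphic ((subgroup_lattice G)\<lparr>carrier := S\<rparr>) M23))) \<and>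
     (distributive_lattice (subgroup_lattice G) \<longleftrightarrow>
        \<not> (\<exists>U V W. subgroup U G \<and> subgroup V G \<and> subgroup W G \<and>
               U \<noteq> {\<one>} \<and> V \<noteq> {\<one>} \<and> W \<noteq> {\<one>} \<and>
               U \<inter> W = {\<one>} \<and> V \<inter> W = {\<one>} \<and>
               U \<squnion>\<^bsub>subgroup_lattice G\<^esub> V = U \<squnion>\<^bsub>subgroup_lattice G\<^esub> W \<and>
               U \<squnion>\<^bsub>subgroup_lattice G\<^esub> W = V \<squnion>\<^bsub>subgroup_lattice G\<^esub> W))"
    (is "(?i \<longleftrightarrow> ?ii) \<and> (?i \<longleftrightarrow> ?iii) \<and> (?i \<longleftrightarrow> \<not> ?N) \<and> (?i \<longleftrightarrow> \<not> ?T)")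
proof -
  interpret comm_group G by (rule assms)
  interpret L: bounded_lattice "subgroup_lattice G" by (rule subgroup_lattice_bounded)
  have T: "?T \<longleftrightarrow> (\<exists>U V W. entangled (subgroup_lattice G) U V W)"
    by (simp only: entangled_subgroup_lattice_iff)
  have "?i \<Longrightarrow> ?iii"
    by (rule pseudocomplemented_if_distributive)
  moreover have "?iii \<Longrightarrow> \<not> ?T"
    unfolding T using L.pseudocomplemented_not_entangled by blast
  moreover have "?N \<Longrightarrow> ?T"
    unfolding T
    using L.entangled_of_zero_sublattice[OF _ _ M3_entangled]
      L.entangled_of_zero_sublattice[OF _ _ M23_entangled] by blast
  moreover have "\<not> common_roots \<Longrightarrow> ?N"
    by (rule forbidden_sublattice_if_no_common_roots)
  moreover have "common_roots \<Longrightarrow> ?i"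
    by (rule distributive_if_common_roots)
  moreover have "?ii \<longleftrightarrow> common_roots"
    by (rule locally_cyclic_iff_common_roots)
  ultimately show ?thesis
    by argo
qed

end
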